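(* Let $\gamma:(0,\infty)\to\mathbb{H}$ be the horizontal lift of the planar curve $t\mapsto(t,\,t\sin\log t)$, $t>0$. Then for any interval $I\subset(0,\infty)$ of positive length, $$\int_0^\infty\int_I K_4(\gamma(s)^{-1}\cdot\gamma(t))\,ds\,dt=\infty.$$
   Context: The Heisenberg group $\mathbb{H}$ is $\mathbb{R}^3$ with the group law $(x,y,z)\cdot(x',y',z')=(x+x',\,y+y',\,z+z'+\tfrac12(xy'-yx'))$, and $\|(x,y,z)\|=((x^2+y^2)^2+z^2)^{1/4}$ is the Koranyi norm. The kernel $K_4:\mathbb{H}\setminus\{0\}\to[0,\infty)$ is $K_4(x,y,z)=\dfrac{|z|^{2}}{\|(x,y,z)\|^{5}}$ (it is undefined only on the null set $s=t$ of the double integral). The horizontal lift of a planar curve $t\mapsto(x(t),y(t))$ is the curve $t\mapsto(x(t),y(t),z(t))$ in $\mathbb{H}$ with $z'(t)=\tfrac12\,(x(t)y'(t)-y(t)x'(t))$; it is determined up to an additive constant in $z$, which does not affect $\gamma(s)^{-1}\cdot\gamma(t)$. *)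

theory Defs
  imports "HOL-Analysis.Analysis"
begin

type_synonym heis = "real \<times> real \<times> real"

fun hmult :: "heis \<Rightarrow> heis \<Rightarrow> heis" (infixl "\<cdot>\<^sub>H" 70) where
  "(x, y, z) \<cdot>\<^sub>H (x', y', z') = (x + x', y + y', z + z' + (x * y' - y * x') / 2)"

fun hinv :: "heis \<Rightarrow> heis" where
  "hinv (x, y, z) = (- x, - y, - z)"

lemma hmult_assoc: "(p \<cdot>\<^sub>H q) \<cdot>\<^sub>H r = p \<cdot>\<^sub>H (q \<cdot>\<^sub>H r)"
  by (cases p; cases q; cases r) (simp add: field_simps)

lemma hmult_unit: "(0, 0, 0) \<cdot>\<^sub>H p = p" "p \<cdot>\<^sub>H (0, 0, 0) = p"
  by (cases p; simp)+

lemma hmult_hinv: "hinv p \<cdot>\<^sub>H p = (0, 0, 0)" "p \<cdot>\<^sub>H hinv p = (0, 0, 0)"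
  by (cases p; simp)+

fun koranyi_norm :: "heis \<Rightarrow> real" where
  "koranyi_norm (x, y, z) = root 4 ((x\<^sup>2 + y\<^sup>2)\<^sup>2 + z\<^sup>2)"

text \<open>At the origin, where the kernel is undefined, division by zero yields the value 0; this is
  only relevant on the diagonal, a null set.\<close>

fun K4 :: "heis \<Rightarrow> real" where
  "K4 (x, y, z) = \<bar>z\<bar> ^ 2 / koranyi_norm (x, y, z) ^ 5"

text \<open>The third coordinate of a horizontal lift is determined only up to an additive constant, so
  being a lift of the planar curve \<open>c\<close> over \<open>S\<close> is a predicate. Values outside \<open>S\<close> are
  unconstrained.\<close>

definition horizontal_lift_on :: "real set \<Rightarrow> (real \<Rightarrow> real \<times> real) \<Rightarrow> (real \<Rightarrow> heis) \<Rightarrow> bool" where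
  "horizontal_lift_on S c \<gamma> \<longleftrightarrow>
    (\<forall>t\<in>S. fst (\<gamma> t) = fst (c t) \<and> fst (snd (\<gamma> t)) = snd (c t) \<and>
      (\<exists>x' y'. (c has_vector_derivative (x', y')) (at t within S) \<and>
        ((\<lambda>u. snd (snd (\<gamma> u))) has_real_derivative
          (fst (c t) * y' - snd (c t) * x') / 2) (at t within S)))"

end

theory Submission
  imports Defs
begin

text \<open>The planar curve oscillates once per multiplicative period \<open>e\<^sup>2\<^sup>\<pi>\<close>, and its lift does the same:
  up to a constant its third coordinate is
  \<open>t\<^sup>2 (2 cos (ln t) + sin (ln t)) / 10\<close>. For \<open>s\<close> in a fixed compact interval and \<open>t\<close> large, the
  point \<open>\<gamma>(s)\<^sup>-\<^sup>1 \<gamma>(t)\<close> has Koranyi norm of order at most \<open>t\<close>, while its third coordinate equals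
  that expression up to an error \<open>O(t)\<close>; so it is of the full order \<open>t\<^sup>2\<close> as long as the phase \<open>ln t\<close> stays
  in a window \<open>[2 n \<pi>, 2 n \<pi> + 1]\<close>, where \<open>2 cos + sin \<ge> 1\<close>. There the kernel is at least a constant
  times \<open>t\<^sup>4 / t\<^sup>5 = 1 / t\<close> (lemma \<open>K4_lift_ge\<close>). Each window contributes the same positive
  amount to the integral of \<open>1 / t\<close>, which is \<open>du\<close> for \<open>u = ln t\<close>, and there are infinitely many
  windows (lemma \<open>nn_integral_reciprocal_windows\<close>).\<close>

definition lift_height :: "real \<Rightarrow> real" where
  "lift_height t = t\<^sup>2 * (2 * cos (ln t) + sin (ln t)) / 10"

text \<open>For this curve \<open>(x y' - y x') / 2\<close> simplifies to \<open>t cos (ln t) / 2\<close>, and \<open>lift_height\<close> is an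
  antiderivative of that; the free additive constant of the lift cancels in the difference.\<close>

lemma lift_height_diff:
  assumes "horizontal_lift_on {0<..} (\<lambda>t. (t, t * sin (ln t))) \<gamma>" "s > 0" "t > 0"
  shows "snd (snd (\<gamma> t)) - snd (snd (\<gamma> s)) = lift_height t - lift_height s"
proof -
  have "((\<lambda>u. snd (snd (\<gamma> u)) - lift_height u) has_field_derivative 0) (at u within {0<..})"
    if u: "u \<in> {0<..}" for u
  proof -
    obtain x' y' where
      c: "((\<lambda>t. (t, t * sin (ln t))) has_vector_derivative (x', y')) (at u within {0<..})"
      and z: "((\<lambda>u. snd (snd (\<gamma> u))) has_real_derivative
          (u * y' - u * sin (ln u) * x') / 2) (at u within {0<..})"
      using assms(1) u unfolding horizontal_lift_on_def fst_conv snd_conv by blast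
    have at_eq: "at u within {0<..} = at u"
      using u by (intro at_within_open) auto
    have "((\<lambda>t. (t, t * sin (ln t))) has_vector_derivative (1, sin (ln u) + cos (ln u))) (at u)"
      using u by (intro has_vector_derivative_Pair; 
          auto intro!: derivative_eq_intros simp flip: has_real_derivative_iff_has_vector_derivative)
    with c have "x' = 1" "y' = sin (ln u) + cos (ln u)"
      unfolding at_eq using vector_derivative_unique_at by blast+
    with z have "((\<lambda>u. snd (snd (\<gamma> u))) has_real_derivative u * cos (ln u) / 2) (at u)"
      unfolding at_eq by (simp add: algebra_simps)
    moreover have "(lift_height has_real_derivative u * cos (ln u) / 2) (at u)"
      unfolding lift_height_def using u
      by (auto intro!: derivative_eq_intros simp: field_simps power2_eq_square)
    ultimately show ?thesis
      unfolding at_eq using DERIV_diff by fastforce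
  qed
  then obtain k where "\<forall>u\<in>{0<..}. snd (snd (\<gamma> u)) - lift_height u = k"
    using has_field_derivative_zero_constant[OF convex_real_interval(3)] by blast
  then have "snd (snd (\<gamma> t)) - lift_height t = k" "snd (snd (\<gamma> s)) - lift_height s = k"
    using assms(2,3) by auto
  then show ?thesis by linarith
qed

lemma abs_lift_height_le: "\<bar>lift_height t\<bar> \<le> 3 / 10 * t\<^sup>2"
proof -
  have "\<bar>2 * cos (ln t) + sin (ln t)\<bar> \<le> 3"
    using abs_cos_le_one[of "ln t"] abs_sin_le_one[of "ln t"] by linarith
  then have "t\<^sup>2 * \<bar>2 * cos (ln t) + sin (ln t)\<bar> \<le> t\<^sup>2 * 3"
    by (intro mult_left_mono) auto
  then show ?thesis by (simp add: lift_height_def abs_mult)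
qed

text \<open>Homogeneous scaling: a point at height comparable to \<open>t\<^sup>2\<close> inside the Koranyi ball of radius
  \<open>3 t\<close> has kernel at least a constant multiple of \<open>(t\<^sup>2)\<^sup>2 / t\<^sup>5\<close>. The coordinate bounds
  give \<open>(x\<^sup>2 + y\<^sup>2)\<^sup>2 + w\<^sup>2 \<le> 26 t\<^sup>4 \<le> (3 t)\<^sup>4\<close>.\<close>

lemma K4_ge:
  assumes "t > 0" "\<bar>x\<bar> \<le> t" "\<bar>y\<bar> \<le> 2 * t" "t\<^sup>2 / 20 \<le> \<bar>w\<bar>" "\<bar>w\<bar> \<le> t\<^sup>2"
  shows "K4 (x, y, w) \<ge> 1 / (97200 * t)"
proof -
  have "x\<^sup>2 \<le> t\<^sup>2" "y\<^sup>2 \<le> (2 * t)\<^sup>2"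
    using power_mono[OF assms(2), of 2] power_mono[OF assms(3), of 2] by simp_all
  then have a: "(x\<^sup>2 + y\<^sup>2)\<^sup>2 \<le> (5 * t\<^sup>2)\<^sup>2"
    by (intro power_mono) (auto simp: power_mult_distrib)
  have b: "w\<^sup>2 \<le> (t\<^sup>2)\<^sup>2"
    using power_mono[OF assms(5), of 2] by simp
  have le: "(x\<^sup>2 + y\<^sup>2)\<^sup>2 + w\<^sup>2 \<le> (3 * t) ^ 4"
  proof -
    have "0 \<le> t ^ 4" by simp
    moreover have "(5 * t\<^sup>2)\<^sup>2 = 25 * t ^ 4" "(t\<^sup>2)\<^sup>2 = t ^ 4" "(3 * t) ^ 4 = 81 * t ^ 4"
      by (simp_all add: power_mult_distrib)
    ultimately show ?thesis using a b by linarith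
  qed
  have "root 4 ((x\<^sup>2 + y\<^sup>2)\<^sup>2 + w\<^sup>2) \<le> root 4 ((3 * t) ^ 4)"
    using le by (intro real_root_le_mono) auto
  also have "\<dots> = 3 * t"
    using assms(1) by (intro real_root_power_cancel) auto
  finally have "koranyi_norm (x, y, w) \<le> 3 * t"
    by (simp only: koranyi_norm.simps)
  moreover have pos: "koranyi_norm (x, y, w) > 0"
  proof -
    have "0 < t\<^sup>2" using assms(1) by simp
    then have "w \<noteq> 0" using assms(4) by auto
    then show ?thesis by (auto intro!: add_nonneg_pos)
  qed
  ultimately have "koranyi_norm (x, y, w) ^ 5 \<le> (3 * t) ^ 5"
    by (intro power_mono) auto
  moreover have "(t\<^sup>2 / 20)\<^sup>2 \<le> \<bar>w\<bar>\<^sup>2"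
    using assms(4) by (intro power_mono) auto
  ultimately have "(t\<^sup>2 / 20)\<^sup>2 / (3 * t) ^ 5 \<le> \<bar>w\<bar>\<^sup>2 / koranyi_norm (x, y, w) ^ 5"
    using pos by (intro frac_le) auto
  moreover have "(t\<^sup>2 / 20)\<^sup>2 / (3 * t) ^ 5 = 1 / (97200 * t)"
    using assms(1) by (simp add: field_simps eval_nat_numeral)
  ultimately show ?thesis by simp
qed

text \<open>When \<open>s\<close> is at most one percent of \<open>t\<close>, the contributions of \<open>s\<close> to the height of
  \<open>\<gamma>(s)\<^sup>-\<^sup>1 \<gamma>(t)\<close> are below \<open>t\<^sup>2 / 20\<close>, hence at most half of \<open>t\<^sup>2 / 10\<close>,
  which bounds the main term from below.\<close>

lemma K4_lift_ge:
  assumes lift: "horizontal_lift_on {0<..} (\<lambda>t. (t, t * sin (ln t))) \<gamma>"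
    and "0 < s" "100 * s \<le> t" and phase: "2 * cos (ln t) + sin (ln t) \<ge> 1"
  shows "K4 (hinv (\<gamma> s) \<cdot>\<^sub>H \<gamma> t) \<ge> 1 / (97200 * t)"
proof -
  define w where
    "w = snd (snd (\<gamma> t)) - snd (snd (\<gamma> s)) + (s * t * (sin (ln s) - sin (ln t))) / 2"
  have t: "t > 0" using assms by linarith
  have eq: "hinv (\<gamma> s) \<cdot>\<^sub>H \<gamma> t = (t - s, t * sin (ln t) - s * sin (ln s), w)"
  proof -
    have "fst (\<gamma> s) = s" "fst (snd (\<gamma> s)) = s * sin (ln s)"
      "fst (\<gamma> t) = t" "fst (snd (\<gamma> t)) = t * sin (ln t)"
      using lift t \<open>0 < s\<close> by (auto simp: horizontal_lift_on_def)
    then show ?thesis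
      by (cases "\<gamma> s"; cases "\<gamma> t") (simp add: w_def algebra_simps)
  qed
  have st: "s * t \<le> t\<^sup>2 / 100" "s\<^sup>2 \<le> t\<^sup>2 / 100"
  proof -
    show 1: "s * t \<le> t\<^sup>2 / 100"
      using mult_right_mono[OF assms(3), of t] t by (simp add: power2_eq_square)
    have "s * s \<le> s * t" using assms by (intro mult_left_mono) auto
    with 1 show "s\<^sup>2 \<le> t\<^sup>2 / 100" by (simp add: power2_eq_square)
  qed
  have y: "\<bar>t * sin (ln t)\<bar> \<le> t" "\<bar>s * sin (ln s)\<bar> \<le> s"
    using t \<open>0 < s\<close> by (auto simp: abs_mult intro!: mult_left_le)
  have cross: "\<bar>s * t * (sin (ln s) - sin (ln t)) / 2\<bar> \<le> s * t"
  proof -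
    have "\<bar>sin (ln s) - sin (ln t)\<bar> \<le> 2"
      using abs_sin_le_one[of "ln s"] abs_sin_le_one[of "ln t"] by linarith
    then have "s * t * \<bar>sin (ln s) - sin (ln t)\<bar> \<le> s * t * 2"
      using t \<open>0 < s\<close> by (intro mult_left_mono) auto
    then show ?thesis using t \<open>0 < s\<close> by (simp add: abs_mult)
  qed
  have "w = lift_height t - lift_height s + s * t * (sin (ln s) - sin (ln t)) / 2"
    unfolding w_def using lift_height_diff[OF lift \<open>0 < s\<close> t] by simp
  moreover have "lift_height t \<ge> t\<^sup>2 / 10"
    using mult_left_mono[OF phase, of "t\<^sup>2"] by (simp add: lift_height_def)
  moreover note abs_lift_height_le[of t] abs_lift_height_le[of s] cross st
  ultimately have "t\<^sup>2 / 20 \<le> w" "w \<le> t\<^sup>2" by linarith+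
  moreover have "0 \<le> t\<^sup>2" by simp
  ultimately have "t\<^sup>2 / 20 \<le> \<bar>w\<bar>" "\<bar>w\<bar> \<le> t\<^sup>2" by linarith+
  moreover have "\<bar>t - s\<bar> \<le> t" "\<bar>t * sin (ln t) - s * sin (ln s)\<bar> \<le> 2 * t"
    using y assms t by linarith+
  ultimately show ?thesis
    unfolding eq using K4_ge t by blast
qed

definition phase_window :: "nat \<Rightarrow> real set" where
  "phase_window n = {exp (2 * pi * n)..exp (2 * pi * n + 1)}"

lemma phase_window_pos: "t \<in> phase_window n \<Longrightarrow> t > 0"
  unfolding phase_window_def atLeastAtMost_iff
  by (rule less_le_trans[OF exp_gt_zero]) (rule conjunct1)

text \<open>The length \<open>1\<close> of a window is below \<open>\<pi> / 3\<close>, so that there \<open>cos \<ge> 1 / 2\<close> and \<open>sin \<ge> 0\<close>.\<close>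

lemma phase_window_ge_1:
  assumes "t \<in> phase_window n"
  shows "2 * cos (ln t) + sin (ln t) \<ge> 1"
proof -
  define v where "v = ln t - 2 * pi * n"
  have t: "t > 0" using assms by (rule phase_window_pos)
  then have "2 * pi * n \<le> ln t" "ln t \<le> 2 * pi * n + 1"
    using assms ln_mono[of t "exp (2 * pi * n + 1)"] by (simp_all add: phase_window_def ln_ge_iff)
  then have v: "0 \<le> v" "v \<le> 1"
    by (simp_all add: v_def)
  have "v \<le> pi / 3" using v pi_gt3 by linarith
  then have "cos (pi / 3) \<le> cos v" using v by (intro cos_monotone_0_pi_le) auto
  moreover have "sin v \<ge> 0" using v pi_gt3 by (intro sin_ge_zero) auto
  moreover have "ln t = v + 2 * real n * pi" by (simp add: v_def)
  then have "cos (ln t) = cos v" "sin (ln t) = sin v"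
    by (simp_all only: sin_add cos_add sin_2npi cos_2npi
        mult_1_right mult_zero_right diff_0_right add_0_right)
  ultimately show ?thesis by (simp add: cos_60)
qed

lemma disjoint_phase_windows: "disjoint_family phase_window"
proof -
  have "False" if "t \<in> phase_window m" "t \<in> phase_window n" "m < n" for m n t
  proof -
    have "exp (2 * pi * n) \<le> t" "t \<le> exp (2 * pi * m + 1)"
      using that by (simp_all add: phase_window_def)
    then have "exp (2 * pi * n) \<le> exp (2 * pi * m + 1)" by (rule order_trans)
    then have "2 * pi * n \<le> 2 * pi * m + 1" by simp
    moreover have "2 * pi * (real m + 1) \<le> 2 * pi * n"
      using \<open>m < n\<close> by (intro mult_left_mono) auto
    ultimately show False using pi_gt3 by (simp add: algebra_simps)
  qed
  then show ?thesis
    unfolding disjoint_family_on_def by (metis disjoint_iff linorder_neqE_nat)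
qed

text \<open>Bounding \<open>1 / t\<close> from below by its value at the right end of a window, that window
  contributes at least \<open>(e - 1) / e\<close>, whatever \<open>n\<close> is. Removing finitely many windows
  therefore leaves the integral infinite.\<close>

lemma nn_integral_reciprocal_windows:
  assumes "c > 0"
  shows "(\<integral>\<^sup>+t\<in>(\<Union>n. phase_window (n + N)). ennreal (c / t) \<partial>lborel) = \<infinity>"
proof -
  have disj: "disjoint_family (\<lambda>n. phase_window (n + N))"
    using disjoint_phase_windows by (fastforce simp: disjoint_family_on_def)
  have [measurable]: "phase_window n \<in> sets borel" for n
    by (simp add: phase_window_def)
  define k where "k = c * (1 - exp (-1))"
  have k: "k > 0" using assms by (simp add: k_def)
  have each: "ennreal k \<le> (\<integral>\<^sup>+t\<in>phase_window n. ennreal (c / t) \<partial>lborel)" for n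
  proof -
    have "ennreal k = ennreal (c / exp (2 * pi * n + 1)) * emeasure lborel (phase_window n)"
      using assms by (simp add: phase_window_def k_def ennreal_mult[symmetric])
        (simp add: exp_add exp_minus field_simps)
    also have "\<dots> = (\<integral>\<^sup>+t\<in>phase_window n. ennreal (c / exp (2 * pi * n + 1)) \<partial>lborel)"
      by (simp add: nn_integral_cmult_indicator)
    also have "\<dots> \<le> (\<integral>\<^sup>+t\<in>phase_window n. ennreal (c / t) \<partial>lborel)"
      using assms phase_window_pos[of _ n]
      by (intro nn_integral_mono)
        (auto simp: indicator_def phase_window_def intro!: ennreal_leI divide_left_mono)
    finally show ?thesis .
  qed
  have "\<infinity> = (\<Sum>n::nat. ennreal k)"
  proof (rule ccontr)
    assume "\<infinity> \<noteq> (\<Sum>n::nat. ennreal k)"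
    then have "summable (\<lambda>n::nat. k)"
      using k by (intro summable_suminf_not_top)
        (simp_all only: infinity_ennreal_def not_sym less_imp_le)
    then show False using k by (simp only: summable_const_iff)
  qed
  also have "\<dots> \<le> (\<Sum>n. \<integral>\<^sup>+t\<in>phase_window (n + N). ennreal (c / t) \<partial>lborel)"
    using each by (intro suminf_le) auto
  also have "\<dots> = (\<integral>\<^sup>+t. (\<Sum>n. ennreal (c / t) * indicator (phase_window (n + N)) t) \<partial>lborel)"
    by (intro nn_integral_suminf[symmetric]) measurable
  also have "\<dots> = (\<integral>\<^sup>+t\<in>(\<Union>n. phase_window (n + N)). ennreal (c / t) \<partial>lborel)"
    by (simp add: suminf_indicator[OF disj])
  finally show ?thesis by (simp add: top_unique)
qed

lemma interval_emeasure_pos_obtains: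
  fixes I :: "real set"
  assumes "is_interval I" "emeasure lborel I > 0"
  obtains a b where "a < b" "{a..b} \<subseteq> I"
proof -
  have "\<exists>a\<in>I. \<exists>b\<in>I. a < b"
  proof (rule ccontr)
    assume "\<not> ?thesis"
    then have "a = b" if "a \<in> I" "b \<in> I" for a b
      using that by (metis linorder_neqE)
    then have "I = {} \<or> (\<exists>a. I = {a})" by blast
    then show False using assms(2) by auto
  qed
  then obtain a b where "a \<in> I" "b \<in> I" "a < b" by blast
  moreover have "{a..b} \<subseteq> I"
  proof
    fix x assume "x \<in> {a..b}"
    then show "x \<in> I"
      by (intro mem_is_interval_1_I[OF assms(1) \<open>a \<in> I\<close> \<open>b \<in> I\<close>]) simp_all
  qed
  ultimately show thesis using that by blast
qed

theorem proposition3p1: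
  fixes \<gamma> :: "real \<Rightarrow> heis" and I :: "real set"
  assumes "horizontal_lift_on {0<..} (\<lambda>t. (t, t * sin (ln t))) \<gamma>"
    and "is_interval I" and "I \<subseteq> {0<..}" and "emeasure lborel I > 0"
  shows "(\<integral>\<^sup>+t\<in>{0<..}. (\<integral>\<^sup>+s\<in>I. ennreal (K4 (hinv (\<gamma> s) \<cdot>\<^sub>H \<gamma> t)) \<partial>lborel) \<partial>lborel) = \<infinity>"
proof -
  obtain a b where ab: "a < b" "{a..b} \<subseteq> I"
    using interval_emeasure_pos_obtains[OF assms(2,4)] .
  then have "a \<in> I" by auto
  then have "a > 0" using assms(3) by auto
  \<comment> \<open>The windows from \<open>N\<close> on lie beyond \<open>100 b\<close>, because \<open>exp (2 \<pi> n) \<ge> n\<close>; there the kernel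
    bound holds for all \<open>s\<close> in \<open>[a, b]\<close> at once.\<close>
  obtain N :: nat where N: "100 * b \<le> N" using real_arch_simple by blast
  define c where "c = (b - a) / 97200"
  have inner: "ennreal (c / t) \<le> (\<integral>\<^sup>+s\<in>I. ennreal (K4 (hinv (\<gamma> s) \<cdot>\<^sub>H \<gamma> t)) \<partial>lborel)"
    if t: "t \<in> phase_window (n + N)" for t n
  proof -
    have "100 * b \<le> t"
    proof -
      have "real N \<le> 2 * pi * real (n + N)"
        using mult_mono[of 1 "2 * pi" "real N" "real (n + N)"] pi_gt3 by simp
      also have "\<dots> \<le> exp (2 * pi * real (n + N))"
        using exp_ge_add_one_self[of "2 * pi * real (n + N)"] by linarith
      also have "\<dots> \<le> t" using t by (simp add: phase_window_def)
      finally show ?thesis using N by linarith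
    qed
    then have K: "1 / (97200 * t) \<le> K4 (hinv (\<gamma> s) \<cdot>\<^sub>H \<gamma> t)" if "s \<in> {a..b}" for s
      using that \<open>a > 0\<close> phase_window_ge_1[OF t] by (intro K4_lift_ge[OF assms(1)]) auto
    have "ennreal (c / t) = ennreal (1 / (97200 * t)) * emeasure lborel {a..b}"
      using ab phase_window_pos[OF t] by (simp add: c_def ennreal_mult[symmetric])
    also have "\<dots> = (\<integral>\<^sup>+s\<in>{a..b}. ennreal (1 / (97200 * t)) \<partial>lborel)"
      by (simp add: nn_integral_cmult_indicator)
    also have "\<dots> \<le> (\<integral>\<^sup>+s\<in>I. ennreal (K4 (hinv (\<gamma> s) \<cdot>\<^sub>H \<gamma> t)) \<partial>lborel)"
      using ab K by (intro nn_integral_mono) (auto simp: indicator_def intro!: ennreal_leI)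
    finally show ?thesis .
  qed
  have "\<infinity> = (\<integral>\<^sup>+t\<in>(\<Union>n. phase_window (n + N)). ennreal (c / t) \<partial>lborel)"
    using nn_integral_reciprocal_windows[of c N] ab by (simp add: c_def)
  also have "\<dots> \<le> (\<integral>\<^sup>+t\<in>{0<..}. (\<integral>\<^sup>+s\<in>I. ennreal (K4 (hinv (\<gamma> s) \<cdot>\<^sub>H \<gamma> t)) \<partial>lborel) \<partial>lborel)"
    using inner phase_window_pos
    by (intro nn_integral_mono) (auto simp: indicator_def)
  finally show ?thesis by (simp add: top_unique)
qed

end
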